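(* For the evacuation problem on the line with exactly one sender and more than one receiver ($n_s=1$, $n_r>1$), there exists an evacuation algorithm with competitive ratio $5$.
   Context: Evacuation problem on the line: $n\ge 2$ agents start at time $0$ at the origin of the real line. Each agent can move in either direction with any speed at most $1$, changing speed and direction instantaneously and arbitrarily often. A target (exit) is at an unknown point $x\in\mathbb{R}$ with $|x|>1$; an agent detects the target when it visits its location. Co-located agents can always exchange information (face-to-face communication). Each agent is either a sender (can transmit messages wirelessly to all other agents at any distance, but can receive messages only face-to-face) or a receiver (can receive wireless messages from any distance, but can transmit only face-to-face); there are $n_s$ senders and $n_r=n-n_s$ receivers. The types of all agents and the algorithm are known to all agents in advance. An evacuation algorithm $\mathcal{A}$ prescribes the movement of every agent, both the search trajectory followed until the agent finds or is informed of the target, and its subsequent actions. $E(\mathcal{A},x)$ is the time at which the last agent reaches the target when it is at $x$, and the competitive ratio is $\mathrm{CR}(\mathcal{A})=\sup_{|x|>1}E(\mathcal{A},x)/|x|$. *)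

theory Defs
  imports "HOL-Analysis.Analysis"
begin

datatype agent_kind = Sender | Receiver

text \<open>
  The agents are the elements of a type \<open>'a\<close> (finite in the theorem).
  Given the actual trajectories \<open>p\<close> of all agents when the target is at \<open>x\<close>,
  \<open>informed kind p x i t\<close> says that agent \<open>i\<close> has found or been told about the target by
  time \<open>t\<close>. Communication is instantaneous, and informed agents always pass on what they
  know; this costs no generality because an informed agent is free to ignore the information.
  A wireless message is sent by a sender and heard by receivers only; every other
  exchange needs co-location.
\<close>

inductive informed ::
  "('a \<Rightarrow> agent_kind) \<Rightarrow> ('a \<Rightarrow> real \<Rightarrow> real) \<Rightarrow> real \<Rightarrow> 'a \<Rightarrow> real \<Rightarrow> bool"
  for kind p x
where
  detect: "0 \<le> t \<Longrightarrow> p i t = x \<Longrightarrow> informed kind p x i t"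
| remember: "informed kind p x i s \<Longrightarrow> s \<le> t \<Longrightarrow> informed kind p x i t"
| face_to_face: "informed kind p x j t \<Longrightarrow> p i t = p j t \<Longrightarrow> informed kind p x i t"
| wireless: "informed kind p x j t \<Longrightarrow> kind j = Sender \<Longrightarrow> kind i = Receiver
    \<Longrightarrow> informed kind p x i t"

text \<open>Speed at most 1, with arbitrary changes of speed and direction, is 1-Lipschitz
  dependence on time. Only times \<open>t \<ge> 0\<close> matter.\<close>

definition feasible_trajectory :: "(real \<Rightarrow> real) \<Rightarrow> bool" where
  "feasible_trajectory f \<longleftrightarrow> f 0 = 0 \<and> 1-lipschitz_on {0..} f"

text \<open>
  \<open>search A i\<close> is the trajectory agent \<open>i\<close> follows as long as it knows nothing of the target;
  \<open>move A x i\<close> is its whole trajectory when the target is at \<open>x\<close>.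
  An uninformed agent must be on its search trajectory, which does not depend on \<open>x\<close>.
  Once informed, it knows \<open>x\<close>, and since the algorithm and the kinds of all agents are
  common knowledge, \<open>x\<close> determines everything else that has happened or will happen;
  hence its subsequent actions may be an arbitrary function of \<open>x\<close> and the time.
\<close>

record 'a algorithm =
  search :: "'a \<Rightarrow> real \<Rightarrow> real"
  move :: "real \<Rightarrow> 'a \<Rightarrow> real \<Rightarrow> real"

definition evacuation_algorithm :: "('a \<Rightarrow> agent_kind) \<Rightarrow> 'a algorithm \<Rightarrow> bool" where
  "evacuation_algorithm kind A \<longleftrightarrow>
     (\<forall>i. feasible_trajectory (search A i)) \<and>
     (\<forall>x i. \<bar>x\<bar> > 1 \<longrightarrow>
        feasible_trajectory (move A x i) \<and>
        (\<forall>t\<ge>0. \<not> informed kind (move A x) x i t \<longrightarrow> move A x i t = search A i t))"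

text \<open>
  An agent that finds the target may leave it again to inform others. It counts
  as having reached the target (as evacuated) only once it is there for good.
  The infimum of the empty set is \<open>\<infinity>\<close>, for agents that never do so.
\<close>

definition arrival_time :: "(real \<Rightarrow> real) \<Rightarrow> real \<Rightarrow> ereal" where
  "arrival_time f x = (INF T\<in>{T. 0 \<le> T \<and> (\<forall>t\<ge>T. f t = x)}. ereal T)"

definition evacuation_time :: "'a algorithm \<Rightarrow> real \<Rightarrow> ereal" where
  "evacuation_time A x = (SUP i. arrival_time (move A x i) x)"

definition competitive_ratio :: "'a algorithm \<Rightarrow> ereal" where
  "competitive_ratio A = (SUP x\<in>{x. \<bar>x\<bar> > 1}. evacuation_time A x / ereal \<bar>x\<bar>)"

end

theory Submission
  imports Defs
begin

text \<open>
  The sender waits at the origin while receivers leave in both directions at full speed.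
  Whoever finds the target returns to the origin at time \<open>2\<bar>x\<bar>\<close> and hands the news
  to the sender, who broadcasts it. The receivers on the wrong side are then at \<open>-2x\<close> and
  reach the target exactly at time \<open>2\<bar>x\<bar> + 3\<bar>x\<bar> = 5\<bar>x\<bar>\<close>; the others are there earlier.
\<close>

text \<open>
  Trajectories oriented so that the target is at \<open>a > 0\<close>: the direction \<open>e\<close> is \<open>1\<close> for the
  finders, \<open>0\<close> for the sender, and \<open>-1\<close> for those who leave away from the target.
\<close>

definition relay_path :: "real \<Rightarrow> real \<Rightarrow> real \<Rightarrow> real" where
  "relay_path a e t =
     (if e = 1 then min t (min a \<bar>t - 2 * a\<bar>)
      else if e = 0 then min a (max 0 (t - 2 * a))
      else min a (max (- t) (t - 4 * a)))"

text \<open>The inner \<open>sgn x\<close> turns the search direction \<open>d i\<close> into the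
  direction relative to the target; the outer one reflects the path back to the actual line.\<close>

definition relay_algorithm :: "('a \<Rightarrow> real) \<Rightarrow> 'a algorithm" where
  "relay_algorithm d =
     \<lparr>search = \<lambda>i t. d i * t, move = \<lambda>x i t. sgn x * relay_path \<bar>x\<bar> (sgn x * d i) t\<rparr>"

lemma relay_path_lipschitz: "\<bar>relay_path a e t - relay_path a e u\<bar> \<le> \<bar>t - u\<bar>"
  unfolding relay_path_def by (smt (verit))

lemma relay_path_0: "a > 0 \<Longrightarrow> relay_path a e 0 = 0"
  unfolding relay_path_def by auto

text \<open>Finders turn around at time \<open>a\<close>; the sender and the agents on the wrong
  side change course only at the broadcast, at time \<open>2 * a\<close>.\<close>

lemma relay_path_before:
  assumes "a > 0" "0 \<le> t" "e \<in> {1, 0, -1}" "e = 1 \<Longrightarrow> t \<le> a" "t \<le> 2 * a"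
  shows "relay_path a e t = e * t"
  using assms unfolding relay_path_def by auto

lemma relay_path_meet: "a > 0 \<Longrightarrow> e \<in> {1, 0} \<Longrightarrow> relay_path a e (2 * a) = 0"
  unfolding relay_path_def by auto

lemma relay_path_after: "a > 0 \<Longrightarrow> t \<ge> 5 * a \<Longrightarrow> relay_path a e t = a"
  unfolding relay_path_def by auto

lemma relay_path_opposite_less: "a > 0 \<Longrightarrow> t \<ge> 0 \<Longrightarrow> t < 5 * a \<Longrightarrow> relay_path a (-1) t < a"
  unfolding relay_path_def by auto

lemma feasible_relay_move:
  assumes "x \<noteq> 0"
  shows "feasible_trajectory (move (relay_algorithm d) x i)"
proof -
  have "1-lipschitz_on {0..} (\<lambda>t. sgn x * relay_path \<bar>x\<bar> (sgn x * d i) t)"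
    using assms relay_path_lipschitz
    by (intro lipschitz_onI)
       (auto simp: dist_real_def abs_mult sgn_if simp flip: right_diff_distrib)
  then show ?thesis
    using assms by (simp add: feasible_trajectory_def relay_algorithm_def relay_path_0)
qed

locale relay =
  fixes kind :: "'a \<Rightarrow> agent_kind" and d :: "'a \<Rightarrow> real"
  assumes direction: "d i \<in> {1, 0, -1}"
    and still: "d i = 0 \<longleftrightarrow> kind i = Sender"
    and ex_sender: "\<exists>i. d i = 0"
    and ex_right: "\<exists>i. d i = 1"
    and ex_left: "\<exists>i. d i = -1"
begin

text \<open>Reflecting the line swaps left and right and fixes the sender, so each of the three
  roles is filled on whichever side the target lies.\<close>

lemma ex_oriented:
  assumes "x \<noteq> 0" "e \<in> {1, 0, -1}"
  shows "\<exists>i. sgn x * d i = e"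
  using assms ex_sender ex_right ex_left
  by (cases "x > 0") (auto simp: sgn_if minus_equation_iff eq_commute[of "-1"])

lemma feasible_search: "feasible_trajectory (search (relay_algorithm d) i)"
  using direction[of i]
  by (auto simp: feasible_trajectory_def relay_algorithm_def dist_real_def intro!: lipschitz_onI)

context
  fixes x :: real
  assumes x: "x \<noteq> 0"
begin

lemma informed_finder:
  assumes "sgn x * d i = 1" "t \<ge> \<bar>x\<bar>"
  shows "informed kind (move (relay_algorithm d) x) x i t"
proof (rule informed.remember[OF informed.detect])
  show "move (relay_algorithm d) x i \<bar>x\<bar> = x"
    using assms x by (simp add: relay_algorithm_def relay_path_before sgn_mult_abs)
qed (use assms in auto)

lemma informed_sender:
  assumes "sgn x * d i = 0" "t \<ge> 2 * \<bar>x\<bar>"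
  shows "informed kind (move (relay_algorithm d) x) x i t"
proof -
  \<comment> \<open>A finder carries the news back and is at the origin, with the sender, at time
    \<open>2 * \<bar>x\<bar>\<close>.\<close>
  obtain j where j: "sgn x * d j = 1"
    using ex_oriented[OF x, of 1] by auto
  have "informed kind (move (relay_algorithm d) x) x i (2 * \<bar>x\<bar>)"
  proof (rule informed.face_to_face)
    show "informed kind (move (relay_algorithm d) x) x j (2 * \<bar>x\<bar>)"
      using j by (rule informed_finder) simp
    show "move (relay_algorithm d) x i (2 * \<bar>x\<bar>) = move (relay_algorithm d) x j (2 * \<bar>x\<bar>)"
      using assms j x relay_path_meet[of "\<bar>x\<bar>"] by (simp add: relay_algorithm_def)
  qed
  then show ?thesis
    using assms(2) by (rule informed.remember)
qed

lemma informed_all: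
  assumes "t \<ge> 2 * \<bar>x\<bar>"
  shows "informed kind (move (relay_algorithm d) x) x i t"
proof (cases "kind i")
  case Sender
  then show ?thesis using assms still by (intro informed_sender) auto
next
  case Receiver
  obtain j where "d j = 0" using ex_sender by blast
  then have "informed kind (move (relay_algorithm d) x) x j t" "kind j = Sender"
    using assms still by (auto intro: informed_sender)
  then show ?thesis using Receiver by (rule informed.wireless)
qed

text \<open>By contraposition, ignorance bounds \<open>t\<close> by the time at which news reaches
  the agent, and until then its path is still the search line.\<close>

lemma uninformed_on_search:
  assumes "t \<ge> 0" "\<not> informed kind (move (relay_algorithm d) x) x i t"
  shows "move (relay_algorithm d) x i t = search (relay_algorithm d) i t"
proof -
  have "t \<le> 2 * \<bar>x\<bar>"
    using assms(2) informed_all by (meson linear)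
  moreover have "t \<le> \<bar>x\<bar>" if "sgn x * d i = 1"
    using assms(2) informed_finder[OF that] by (meson linear)
  moreover have "sgn x * d i \<in> {1, 0, -1}"
    using direction[of i] x by (auto simp: sgn_if)
  ultimately have "relay_path \<bar>x\<bar> (sgn x * d i) t = sgn x * d i * t"
    using assms(1) x by (intro relay_path_before) auto
  \<comment> \<open>The two factors \<open>sgn x\<close> cancel.\<close>
  then show ?thesis
    using x by (simp add: relay_algorithm_def sgn_if)
qed

lemma evacuation_time_relay: "evacuation_time (relay_algorithm d) x = ereal (5 * \<bar>x\<bar>)"
proof (rule antisym)
  have "move (relay_algorithm d) x i t = x" if "t \<ge> 5 * \<bar>x\<bar>" for i t
    using that x by (simp add: relay_algorithm_def relay_path_after sgn_mult_abs)
  then show "evacuation_time (relay_algorithm d) x \<le> ereal (5 * \<bar>x\<bar>)"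
    unfolding evacuation_time_def arrival_time_def by (intro SUP_least INF_lower) auto
next
  \<comment> \<open>An agent that left away from the target attains the bound: it stays strictly
    short of the target before \<open>5 * \<bar>x\<bar>\<close>.\<close>
  obtain i where i: "sgn x * d i = -1"
    using ex_oriented[OF x, of "-1"] by auto
  have "5 * \<bar>x\<bar> \<le> T" if "T \<ge> 0" "\<forall>t\<ge>T. move (relay_algorithm d) x i t = x" for T
  proof (rule ccontr)
    assume "\<not> 5 * \<bar>x\<bar> \<le> T"
    then have "relay_path \<bar>x\<bar> (-1) T < \<bar>x\<bar>"
      using that x by (intro relay_path_opposite_less) auto
    moreover have "sgn x * relay_path \<bar>x\<bar> (-1) T = x"
      using that(2) i by (simp add: relay_algorithm_def)
    ultimately show False
      using x by (auto simp: sgn_if split: if_splits)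
  qed
  then have "ereal (5 * \<bar>x\<bar>) \<le> arrival_time (move (relay_algorithm d) x i) x"
    unfolding arrival_time_def by (intro INF_greatest) auto
  also have "\<dots> \<le> evacuation_time (relay_algorithm d) x"
    unfolding evacuation_time_def by (rule SUP_upper) simp
  finally show "ereal (5 * \<bar>x\<bar>) \<le> evacuation_time (relay_algorithm d) x" .
qed

end

lemma evacuation_algorithm_relay: "evacuation_algorithm kind (relay_algorithm d)"
  unfolding evacuation_algorithm_def
  by (intro conjI allI impI feasible_search feasible_relay_move uninformed_on_search) auto

lemma competitive_ratio_relay: "competitive_ratio (relay_algorithm d) = 5"
proof -
  have "evacuation_time (relay_algorithm d) x / ereal \<bar>x\<bar> = 5" if "\<bar>x\<bar> > 1" for x
    using that by (subst evacuation_time_relay) auto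
  \<comment> \<open>Over an empty index set the supremum of the constant 5 would be
    \<open>-\<infinity>\<close>.\<close>
  moreover have "{x::real. \<bar>x\<bar> > 1} \<noteq> {}"
    by (auto intro: exI[of _ 2])
  ultimately show ?thesis
    unfolding competitive_ratio_def by simp
qed

end

theorem theorem2:
  fixes kind :: "'a::finite \<Rightarrow> agent_kind"
  assumes "card {i. kind i = Sender} = 1"
    and "card {i. kind i = Receiver} > 1"
  shows "\<exists>A. evacuation_algorithm kind A \<and> competitive_ratio A = 5"
proof -
  obtain s where s: "kind s = Sender"
    using assms(1) by (auto simp del: One_nat_def elim!: card_1_singletonE)
  obtain l r where lr: "kind l = Receiver" "kind r = Receiver" "l \<noteq> r"
    using assms(2) card_le_Suc0_iff_eq[of "{i. kind i = Receiver}"] by auto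
  \<comment> \<open>One receiver \<open>l\<close> goes left and all others go right;
    \<open>r\<close> ensures that the right side is searched too.\<close>
  define d :: "'a \<Rightarrow> real" where
    "d i = (if kind i = Sender then 0 else if i = l then -1 else 1)" for i
  interpret relay kind d
  proof
    have "d s = 0" "d r = 1" "d l = -1"
      using s lr by (auto simp: d_def)
    then show "\<exists>i. d i = 0" "\<exists>i. d i = 1" "\<exists>i. d i = -1"
      by blast+
  qed (auto simp: d_def)
  show ?thesis
    using evacuation_algorithm_relay competitive_ratio_relay by blast
qed

end
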